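(* Suppose that the supply curves $D_j$, $j\in\mathcal T$, are continuous functions (and non-decreasing, with values in $[0,\infty)$), and that the optimization problem (OPT) has a feasible solution. Then there exists an optimal solution $(b^*,\gamma^* )$ of (OPT) for which the following holds. There is a set of bid values $\mathcal P(b^*,\gamma^* )\subset[0,\infty)$ such that with every $p^*\in\mathcal P(b^*,\gamma^* )$ one can associate a component $\mathcal C(p^* )=(\mathcal C_c(p^* ),\mathcal C_t(p^* ))$, where $\mathcal C_c(p^* )\subseteq\mathcal N$ is a set of campaigns and $\mathcal C_t(p^* )\subseteq\mathcal T$ is a set of targeting groups, with $$\mathcal A_i(b^*,\gamma^* )\cap\mathcal C_t(p^* )=\mathcal A_i(b^*,\gamma^* ),\quad i\in\mathcal C_c(p^* ),$$ $$\mathcal B_j(b^*,\gamma^* )\cap\mathcal C_c(p^* )=\mathcal B_j(b^*,\gamma^* ),\quad j\in\mathcal C_t(p^* ),$$ $$b^*_{i,j}=p^*,\quad i\in\mathcal C_c(p^* ),\ j\in\mathcal A_i(b^*,\gamma^* ).$$ In addition, $$\bigcup_{p^*\in\mathcal P(b^*,\gamma^* )}\mathcal C_c(p^* )=\mathcal N\quad\text{and}\quad\bigcup_{p^*\in\mathcal P(b^*,\gamma^* )}\mathcal C_t(p^* )=\mathcal T.$$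
   Context: Model: $\mathcal N=\{1,\dots,N_c\}$ is a finite set of campaigns and $\mathcal T=\{1,\dots,N_r\}$ a finite set of targeting groups. Campaign $i$ requires $I_i\ge 0$ impressions and may bid only on the targeting groups in a given set $\mathcal A_i\subseteq\mathcal T$; for $j\in\mathcal T$ put $\mathcal B_j=\{i\in\mathcal N: j\in\mathcal A_i\}$, and every $\mathcal B_j$ is nonempty. Targeting group $j$ has a supply curve $D_j:[0,\infty)\to[0,\infty)$. An allocation $(b,\gamma)$ consists of bid values $b_{i,j}\ge 0$ and fractions $\gamma_{i,j}\ge 0$ for all pairs with $j\in\mathcal A_i$ (equivalently $i\in\mathcal B_j$); $\gamma_{i,j}=0$ for $j\notin\mathcal A_i$. Problem (OPT): minimize over allocations $$\sum_{i=1}^{N_c}\sum_{j=1}^{N_r}\gamma_{i,j}\Big(D_j(b_{i,j})b_{i,j}-\int_0^{b_{i,j}}D_j(x)\,dx\Big)$$ subject to $\sum_{j\in\mathcal A_i}\gamma_{i,j}D_j(b_{i,j})\ge I_i$ for all $i\in\mathcal N$, $\sum_{i\in\mathcal B_j}\gamma_{i,j}\le 1$ for all $j\in\mathcal T$, $b_{i,j}\ge0$, $\gamma_{i,j}\ge 0$. For a feasible allocation, $\mathcal A_i(b^*,\gamma^* )=\{j\in\mathcal A_i:\gamma^*_{i,j}D_j(b^*_{i,j})>0\}$ and $\mathcal B_j(b^*,\gamma^* )=\{i\in\mathcal B_j:\gamma^*_{i,j}D_j(b^*_{i,j})>0\}$. *)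

theory Defs
  imports "HOL-Analysis.Analysis"
begin

text \<open>
  Campaigns are \<open>{1..Nc}\<close>, targeting groups are \<open>{1..Nr}\<close>. An instance is given by the sets
  \<open>A i\<close> of targeting groups campaign \<open>i\<close> may bid on, the impression requirements \<open>I i\<close> and the
  supply curves \<open>D j\<close>. An allocation is a pair \<open>b\<close>, \<open>\<gamma>\<close> of functions of a campaign and a
  targeting group. Bids \<open>b i j\<close> with \<open>j \<notin> A i\<close>, and all values at indices outside
  \<open>{1..Nc}\<close> and \<open>{1..Nr}\<close>, are unconstrained and play no role.
\<close>

definition bidders :: "nat \<Rightarrow> (nat \<Rightarrow> nat set) \<Rightarrow> nat \<Rightarrow> nat set" where
  "bidders Nc A j = {i \<in> {1..Nc}. j \<in> A i}"

definition supply_curve :: "(real \<Rightarrow> real) \<Rightarrow> bool" where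
  "supply_curve f \<longleftrightarrow> (\<forall>x\<ge>0. 0 \<le> f x) \<and> mono_on {0..} f"

definition allocation ::
  "nat \<Rightarrow> nat \<Rightarrow> (nat \<Rightarrow> nat set) \<Rightarrow> (nat \<Rightarrow> nat \<Rightarrow> real) \<Rightarrow> (nat \<Rightarrow> nat \<Rightarrow> real) \<Rightarrow> bool" where
  "allocation Nc Nr A b \<gamma> \<longleftrightarrow>
     (\<forall>i\<in>{1..Nc}. \<forall>j\<in>A i. 0 \<le> b i j \<and> 0 \<le> \<gamma> i j) \<and>
     (\<forall>i\<in>{1..Nc}. \<forall>j\<in>{1..Nr} - A i. \<gamma> i j = 0)"

definition cost ::
  "nat \<Rightarrow> nat \<Rightarrow> (nat \<Rightarrow> real \<Rightarrow> real) \<Rightarrow> (nat \<Rightarrow> nat \<Rightarrow> real) \<Rightarrow> (nat \<Rightarrow> nat \<Rightarrow> real) \<Rightarrow> real" where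
  "cost Nc Nr D b \<gamma> =
     (\<Sum>i\<in>{1..Nc}. \<Sum>j\<in>{1..Nr}. \<gamma> i j * (D j (b i j) * b i j - integral {0..b i j} (D j)))"

definition feasible ::
  "nat \<Rightarrow> nat \<Rightarrow> (nat \<Rightarrow> nat set) \<Rightarrow> (nat \<Rightarrow> real) \<Rightarrow> (nat \<Rightarrow> real \<Rightarrow> real) \<Rightarrow>
    (nat \<Rightarrow> nat \<Rightarrow> real) \<Rightarrow> (nat \<Rightarrow> nat \<Rightarrow> real) \<Rightarrow> bool" where
  "feasible Nc Nr A I D b \<gamma> \<longleftrightarrow>
     allocation Nc Nr A b \<gamma> \<and>
     (\<forall>i\<in>{1..Nc}. I i \<le> (\<Sum>j\<in>A i. \<gamma> i j * D j (b i j))) \<and>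
     (\<forall>j\<in>{1..Nr}. (\<Sum>i\<in>bidders Nc A j. \<gamma> i j) \<le> 1)"

definition optimal ::
  "nat \<Rightarrow> nat \<Rightarrow> (nat \<Rightarrow> nat set) \<Rightarrow> (nat \<Rightarrow> real) \<Rightarrow> (nat \<Rightarrow> real \<Rightarrow> real) \<Rightarrow>
    (nat \<Rightarrow> nat \<Rightarrow> real) \<Rightarrow> (nat \<Rightarrow> nat \<Rightarrow> real) \<Rightarrow> bool" where
  "optimal Nc Nr A I D b \<gamma> \<longleftrightarrow>
     feasible Nc Nr A I D b \<gamma> \<and>
     (\<forall>b' \<gamma>'. feasible Nc Nr A I D b' \<gamma>' \<longrightarrow> cost Nc Nr D b \<gamma> \<le> cost Nc Nr D b' \<gamma>')"

definition active_targets ::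
  "(nat \<Rightarrow> nat set) \<Rightarrow> (nat \<Rightarrow> real \<Rightarrow> real) \<Rightarrow> (nat \<Rightarrow> nat \<Rightarrow> real) \<Rightarrow> (nat \<Rightarrow> nat \<Rightarrow> real) \<Rightarrow>
    nat \<Rightarrow> nat set" where
  "active_targets A D b \<gamma> i = {j \<in> A i. \<gamma> i j * D j (b i j) > 0}"

definition active_bidders ::
  "nat \<Rightarrow> (nat \<Rightarrow> nat set) \<Rightarrow> (nat \<Rightarrow> real \<Rightarrow> real) \<Rightarrow> (nat \<Rightarrow> nat \<Rightarrow> real) \<Rightarrow> (nat \<Rightarrow> nat \<Rightarrow> real) \<Rightarrow>
    nat \<Rightarrow> nat set" where
  "active_bidders Nc A D b \<gamma> j = {i \<in> bidders Nc A j. \<gamma> i j * D j (b i j) > 0}"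

end

theory Submission
  imports Defs
begin

text \<open>
  The proof goes through the Lagrangian dual. Give every campaign \<open>i\<close> a multiplier \<open>\<pi> i \<ge> 0\<close>
  for its demand constraint. For fixed \<open>\<pi>\<close> the Lagrangian is minimised by letting campaign
  \<open>i\<close> bid \<open>\<pi> i\<close> everywhere and giving each group \<open>j\<close> to the highest bidders, so the dual
  objective is \<open>\<Sum>i. \<pi> i * I i\<close> minus the sum over \<open>j\<close> of the integral of \<open>D j\<close> from \<open>0\<close> to
  the maximum of \<open>\<pi>\<close> over the bidders of \<open>j\<close>. It attains its maximum, and at a maximiser the
  first-order conditions are exactly the solvability condition of a transportation problem that
  yields fractions \<open>\<gamma>\<close> supported on the highest bidders and without duality gap. The bids of this
  optimal solution depend only on the campaign, and on the support of \<open>\<gamma>\<close> only on the group;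
  the components are the level sets of these bids.
\<close>

section \<open>Compactness and continuity on function spaces\<close>

text \<open>Tychonoff's theorem for the product topology on functions. It makes boxes of multipliers
  and of fractions compact even over infinite index types.\<close>

lemma compact_box:
  fixes C :: "'a \<Rightarrow> 'b::topological_space set"
  assumes "\<And>i. compact (C i)"
  shows "compact {x. \<forall>i. x i \<in> C i}"
proof -
  have "compactin (product_topology (\<lambda>i. euclidean) UNIV) (PiE UNIV C)"
    using assms by (subst compactin_PiE) auto
  then show ?thesis
    by (simp add: euclidean_product_topology PiE_UNIV_domain Pi_def)
qed

lemma continuous_on_Max_image:
  fixes f :: "'a \<Rightarrow> 'b::topological_space \<Rightarrow> real"
  assumes "finite J" "J \<noteq> {}" "\<And>i. i \<in> J \<Longrightarrow> continuous_on S (f i)"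
  shows "continuous_on S (\<lambda>x. Max ((\<lambda>i. f i x) ` J))"
  using assms
proof (induction J rule: finite_ne_induct)
  case (insert i J)
  then have "continuous_on S (\<lambda>x. max (f i x) (Max ((\<lambda>i. f i x) ` J)))"
    by (intro continuous_on_max) auto
  with insert show ?case by simp
qed simp

section \<open>Integrals of supply curves\<close>

lemma integrable_on_Icc_if_continuous_nonneg:
  fixes f :: "real \<Rightarrow> real"
  assumes "continuous_on {0..} f" "0 \<le> x"
  shows "f integrable_on {x..y}"
  by (intro integrable_continuous_real continuous_on_subset[OF assms(1)]) (use assms in auto)

text \<open>The integral of a non-decreasing continuous curve is convex with slope
  \<open>f x\<close> at \<open>x\<close>, so it lies above its tangent there. Both cases compare
  \<open>f\<close> with the constant \<open>f x\<close> between \<open>x\<close> and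
  \<open>y\<close>.\<close>

lemma supply_curve_integral_tangent:
  assumes "supply_curve f" "continuous_on {0..} f" "0 \<le> x" "0 \<le> y"
  shows "f x * (y - x) \<le> integral {0..y} f - integral {0..x} f"
proof (cases "x \<le> y")
  case True
  have "integral {0..x} f + integral {x..y} f = integral {0..y} f"
    by (intro Henstock_Kurzweil_Integration.integral_combine integrable_on_Icc_if_continuous_nonneg)
      (use assms True in auto)
  moreover have "integral {x..y} (\<lambda>_. f x) \<le> integral {x..y} f"
    by (intro integral_le integrable_on_Icc_if_continuous_nonneg)
      (use assms True in \<open>auto simp: supply_curve_def mono_on_def\<close>)
  ultimately show ?thesis using True by (simp add: mult.commute)
next
  case False
  have "integral {0..y} f + integral {y..x} f = integral {0..x} f"
    by (intro Henstock_Kurzweil_Integration.integral_combine integrable_on_Icc_if_continuous_nonneg)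
      (use assms False in auto)
  moreover have "integral {y..x} f \<le> integral {y..x} (\<lambda>_. f x)"
    by (intro integral_le integrable_on_Icc_if_continuous_nonneg)
      (use assms False in \<open>auto simp: supply_curve_def mono_on_def\<close>)
  ultimately show ?thesis using False by (simp add: algebra_simps)
qed

lemma supply_curve_integral_mono:
  assumes "supply_curve f" "continuous_on {0..} f" "0 \<le> x" "x \<le> y"
  shows "integral {0..x} f \<le> integral {0..y} f"
proof -
  have "0 \<le> f x * (y - x)" using assms by (simp add: supply_curve_def)
  with supply_curve_integral_tangent[of f x y] assms show ?thesis by linarith
qed

section \<open>Solvability of a transportation problem\<close>

text \<open>Extracts a first-order condition from a variational inequality. If \<open>a\<close> were
  positive, \<open>t = a / (2 * c)\<close> would give \<open>a \<le> a / 2\<close>; this step is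
  admissible because \<open>t = 1\<close> yields \<open>a \<le> c\<close>.\<close>

lemma nonpos_if_le_small_multiples:
  fixes a c :: real
  assumes "\<And>t. 0 < t \<Longrightarrow> t \<le> 1 \<Longrightarrow> a \<le> t * c"
  shows "a \<le> 0"
proof (rule ccontr)
  assume "\<not> a \<le> 0"
  then have a: "0 < a" by simp
  have c: "a \<le> c" using assms[of 1] by simp
  have "a \<le> a / (2 * c) * c" using a c by (intro assms) (auto simp: field_simps)
  then show False using a c by (simp add: field_simps)
qed

text \<open>A form of Farkas' lemma for transportation polytopes. The assignment minimises the sum of
  squares of the unmet demands \<open>v\<close>; the condition for \<open>v\<close> itself then forces \<open>v = 0\<close>.\<close>

lemma fractional_assignment:
  fixes d :: "'b \<Rightarrow> real" and h :: "'a \<Rightarrow> real" and E :: "'b \<Rightarrow> 'a set"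
  assumes fin: "finite N" "finite T"
    and E: "\<And>j. j \<in> T \<Longrightarrow> E j \<noteq> {}" "\<And>j. j \<in> T \<Longrightarrow> E j \<subseteq> N"
    and cond: "\<And>v. (\<And>i. i \<in> Z \<Longrightarrow> 0 \<le> v i) \<Longrightarrow>
      (\<Sum>i\<in>N. v i * h i) \<le> (\<Sum>j\<in>T. d j * Max (v ` E j))"
  obtains \<gamma> :: "'a \<Rightarrow> 'b \<Rightarrow> real"
  where "\<And>i j. 0 \<le> \<gamma> i j" "\<And>i j. j \<in> T \<Longrightarrow> i \<notin> E j \<Longrightarrow> \<gamma> i j = 0"
    "\<And>j. j \<in> T \<Longrightarrow> (\<Sum>i\<in>N. \<gamma> i j) = 1"
    "\<And>i. i \<in> N \<Longrightarrow> h i \<le> (\<Sum>j\<in>T. \<gamma> i j * d j)"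
    "\<And>i. i \<in> N - Z \<Longrightarrow> h i = (\<Sum>j\<in>T. \<gamma> i j * d j)"
proof -
  define G :: "('a \<Rightarrow> 'b \<Rightarrow> real) set" where
    "G = {\<gamma>. \<forall>i j. \<gamma> i j \<in> {0..1}} \<inter>
      (\<Inter>j\<in>T. {\<gamma>. (\<forall>i. i \<notin> E j \<longrightarrow> \<gamma> i j = 0) \<and> (\<Sum>i\<in>N. \<gamma> i j) = 1})"
  define k where "k \<gamma> i = (\<Sum>j\<in>T. \<gamma> i j * d j)" for \<gamma> and i :: 'a
  \<comment> \<open>On \<open>Z\<close> only a shortfall counts as an error, elsewhere an excess
    counts too. Vanishing residuals thus mean an inequality on \<open>Z\<close> and an equality off
    it, and residuals on \<open>Z\<close> have the sign that \<open>cond\<close> requires.\<close>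
  define r where "r i x = (if i \<in> Z then max x 0 else x)" for i :: 'a and x :: real
  define V where "V \<gamma> = (\<Sum>i\<in>N. (r i (h i - k \<gamma> i))\<^sup>2)" for \<gamma>
  have coord: "continuous_on S (\<lambda>\<gamma>. \<gamma> i j)" for S :: "('a \<Rightarrow> 'b \<Rightarrow> real) set" and i j
    by (rule continuous_on_product_then_coordinatewise
          [OF continuous_on_product_then_coordinatewise[OF continuous_on_id]])
  have "compact {\<gamma> :: 'a \<Rightarrow> 'b \<Rightarrow> real. \<forall>i. \<gamma> i \<in> {x. \<forall>j. x j \<in> {0..1}}}"
    by (intro compact_box) auto
  then have "compact {\<gamma> :: 'a \<Rightarrow> 'b \<Rightarrow> real. \<forall>i j. \<gamma> i j \<in> {0..1}}" by simp
  moreover have "closed {\<gamma> :: 'a \<Rightarrow> 'b \<Rightarrow> real. (\<forall>i. i \<notin> E j \<longrightarrow> \<gamma> i j = 0) \<and> (\<Sum>i\<in>N. \<gamma> i j) = 1}"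
    for j
    by (intro closed_Collect_conj closed_Collect_all closed_Collect_imp closed_Collect_eq
        continuous_intros coord open_Collect_const)
  ultimately have compact: "compact G"
    unfolding G_def by (intro compact_Int_closed closed_INT) auto
  have conc: "(\<lambda>i j. if j \<in> T \<and> i = e j then 1 else 0) \<in> G" if "\<And>j. j \<in> T \<Longrightarrow> e j \<in> E j" for e
    using that E fin by (auto simp: G_def sum.delta' subset_iff)
  have "G \<noteq> {}" using conc[of "\<lambda>j. SOME i. i \<in> E j"] E(1) some_in_eq by blast
  moreover have "continuous_on G V"
  proof -
    have "continuous_on G (\<lambda>\<gamma>. r i (h i - k \<gamma> i))" for i
      unfolding r_def k_def by (cases "i \<in> Z"; simp; intro continuous_intros coord)
    then show ?thesis unfolding V_def by (intro continuous_intros)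
  qed
  ultimately obtain \<gamma> where \<gamma>: "\<gamma> \<in> G" and min: "\<And>\<gamma>'. \<gamma>' \<in> G \<Longrightarrow> V \<gamma> \<le> V \<gamma>'"
    using continuous_attains_inf[OF compact] by blast
  define v where "v i = r i (h i - k \<gamma> i)" for i
  have "\<exists>i. i \<in> E j \<and> v i = Max (v ` E j)" if "j \<in> T" for j
  proof -
    have "Max (v ` E j) \<in> v ` E j"
      using E[OF that] fin by (intro Max_in) (auto intro: finite_subset)
    then show ?thesis by auto
  qed
  \<comment> \<open>Giving each \<open>j\<close> wholly to a member of \<open>E j\<close> with the
    largest residual makes the right-hand side of \<open>cond\<close> for \<open>v\<close> the value
    of an actual assignment.\<close>
  then obtain e where e: "\<And>j. j \<in> T \<Longrightarrow> e j \<in> E j" "\<And>j. j \<in> T \<Longrightarrow> v (e j) = Max (v ` E j)"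
    by metis
  define \<gamma>' :: "'a \<Rightarrow> 'b \<Rightarrow> real" where "\<gamma>' = (\<lambda>i j. if j \<in> T \<and> i = e j then 1 else 0)"
  define \<delta> where "\<delta> i = k \<gamma>' i - k \<gamma> i" for i
  have \<gamma>': "\<gamma>' \<in> G" unfolding \<gamma>'_def by (rule conc) (rule e)
  \<comment> \<open>First-order condition for the minimiser: move from \<open>\<gamma>\<close>
    towards \<open>\<gamma>'\<close> by the fraction \<open>t\<close> and stay in the convex set
    \<open>G\<close>.\<close>
  have "2 * (\<Sum>i\<in>N. v i * \<delta> i) \<le> t * (\<Sum>i\<in>N. (\<delta> i)\<^sup>2)" if t: "0 < t" "t \<le> 1" for t
  proof -
    define \<gamma>t where "\<gamma>t i j = (1 - t) * \<gamma> i j + t * \<gamma>' i j" for i j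
    have "\<gamma>t i j \<in> {0..1}" for i j
    proof -
      have "\<gamma> i j \<in> {0..1}" "\<gamma>' i j \<in> {0..1}" using \<gamma> \<gamma>' by (auto simp: G_def)
      then show ?thesis using t convexD_alt[OF convex_real_interval(5)[of 0 1], of "\<gamma> i j" "\<gamma>' i j" t]
        by (simp add: \<gamma>t_def)
    qed
    then have "\<gamma>t \<in> G" using \<gamma> \<gamma>'
      by (auto simp: G_def \<gamma>t_def sum.distrib simp flip: sum_distrib_left)
    then have "V \<gamma> \<le> V \<gamma>t" by (rule min)
    \<comment> \<open>Truncation only lowers the square: where it acts the left side is zero, and
      otherwise \<open>v i\<close> is at least the untruncated residual at \<open>\<gamma>\<close>,
      with equality off \<open>Z\<close>.\<close>
    also have "V \<gamma>t \<le> (\<Sum>i\<in>N. (v i - t * \<delta> i)\<^sup>2)"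
      unfolding V_def
    proof (rule sum_mono)
      fix i
      have k: "h i - k \<gamma>t i = (h i - k \<gamma> i) - t * \<delta> i"
        by (simp add: k_def \<delta>_def \<gamma>t_def sum_distrib_left sum_subtractf sum.distrib algebra_simps)
      show "(r i (h i - k \<gamma>t i))\<^sup>2 \<le> (v i - t * \<delta> i)\<^sup>2"
      proof (cases "i \<in> Z \<and> h i - k \<gamma>t i \<ge> 0")
        case True
        then show ?thesis unfolding v_def k by (auto simp: r_def max_def intro!: power_mono)
      qed (auto simp: r_def v_def k max_def)
    qed
    also have "\<dots> = V \<gamma> - 2 * t * (\<Sum>i\<in>N. v i * \<delta> i) + t\<^sup>2 * (\<Sum>i\<in>N. (\<delta> i)\<^sup>2)"
      by (simp add: V_def v_def power2_diff sum.distrib sum_subtractf sum_distrib_left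
          power_mult_distrib algebra_simps)
    finally have "t * (2 * (\<Sum>i\<in>N. v i * \<delta> i)) \<le> t * (t * (\<Sum>i\<in>N. (\<delta> i)\<^sup>2))"
      by (simp add: power2_eq_square algebra_simps)
    then show ?thesis using t by simp
  qed
  from nonpos_if_le_small_multiples[OF this]
  have "(\<Sum>i\<in>N. v i * \<delta> i) \<le> 0" by simp
  then have "(\<Sum>i\<in>N. v i * k \<gamma>' i) \<le> (\<Sum>i\<in>N. v i * k \<gamma> i)"
    by (simp add: \<delta>_def algebra_simps sum_subtractf)
  moreover have "(\<Sum>i\<in>N. v i * k \<gamma>' i) = (\<Sum>j\<in>T. d j * Max (v ` E j))"
  proof -
    have "(\<Sum>i\<in>N. v i * k \<gamma>' i) = (\<Sum>j\<in>T. \<Sum>i\<in>N. if i = e j then v i * d j else 0)"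
      unfolding k_def \<gamma>'_def sum_distrib_left
      by (subst sum.swap) (auto intro!: sum.cong)
    also have "\<dots> = (\<Sum>j\<in>T. d j * Max (v ` E j))"
      using e E fin by (intro sum.cong) (auto simp: sum.delta' subset_iff)
    finally show ?thesis .
  qed
  moreover have "(\<Sum>i\<in>N. v i * h i) \<le> (\<Sum>j\<in>T. d j * Max (v ` E j))"
    by (rule cond) (simp add: v_def r_def)
  ultimately have "(\<Sum>i\<in>N. v i * (h i - k \<gamma> i)) \<le> 0"
    by (simp add: right_diff_distrib sum_subtractf)
  \<comment> \<open>Either \<open>r\<close> truncates and \<open>v i\<close> is zero, or
    \<open>v i\<close> is the residual itself.\<close>
  moreover have "v i * (h i - k \<gamma> i) = (v i)\<^sup>2" for i
    by (auto simp: v_def r_def power2_eq_square max_def)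
  ultimately have "(\<Sum>i\<in>N. (v i)\<^sup>2) \<le> 0" by simp
  then have "(\<Sum>i\<in>N. (v i)\<^sup>2) = 0"
    by (intro order.antisym sum_nonneg) auto
  then have "v i = 0" if "i \<in> N" for i
    using fin that by (simp add: sum_nonneg_eq_0_iff)
  then show ?thesis
    using \<gamma> by (intro that[of \<gamma>]) (fastforce simp: G_def v_def r_def k_def max_def split: if_splits)+
qed

section \<open>The market and its dual objective\<close>

locale ad_market =
  fixes Nc Nr :: nat
    and A :: "nat \<Rightarrow> nat set"
    and I :: "nat \<Rightarrow> real"
    and D :: "nat \<Rightarrow> real \<Rightarrow> real"
  assumes A_subset: "\<And>i. i \<in> {1..Nc} \<Longrightarrow> A i \<subseteq> {1..Nr}"
    and bidders_nonempty: "\<And>j. j \<in> {1..Nr} \<Longrightarrow> bidders Nc A j \<noteq> {}"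
    and supply_D: "\<And>j. j \<in> {1..Nr} \<Longrightarrow> supply_curve (D j)"
    and cont_D: "\<And>j. j \<in> {1..Nr} \<Longrightarrow> continuous_on {0..} (D j)"
begin

text \<open>The best net value of a full share of group \<open>j\<close> at multiplier
  \<open>x\<close>: bidding \<open>b\<close> yields \<open>D j b * x\<close> minus the cost
  \<open>D j b * b - F j b\<close>, which by the tangent inequality is at most \<open>F j x\<close>,
  with equality at \<open>b = x\<close>.\<close>

definition F :: "nat \<Rightarrow> real \<Rightarrow> real" where
  "F j x = integral {0..x} (D j)"

definition top_bid :: "(nat \<Rightarrow> real) \<Rightarrow> nat \<Rightarrow> real" where
  "top_bid \<pi> j = Max (\<pi> ` bidders Nc A j)"

definition dual :: "(nat \<Rightarrow> real) \<Rightarrow> real" where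
  "dual \<pi> = (\<Sum>i\<in>{1..Nc}. \<pi> i * I i) - (\<Sum>j\<in>{1..Nr}. F j (top_bid \<pi> j))"

lemma finite_bidders [simp]: "finite (bidders Nc A j)"
  by (simp add: bidders_def)

lemma finite_A: "i \<in> {1..Nc} \<Longrightarrow> finite (A i)"
  using A_subset finite_subset by blast

lemma sum_swap_bidders:
  fixes g :: "nat \<Rightarrow> nat \<Rightarrow> real"
  shows "(\<Sum>i\<in>{1..Nc}. \<Sum>j\<in>A i. g i j) = (\<Sum>j\<in>{1..Nr}. \<Sum>i\<in>bidders Nc A j. g i j)"
proof -
  have "(\<Sum>i\<in>{1..Nc}. \<Sum>j\<in>A i. g i j) = (\<Sum>i\<in>{1..Nc}. \<Sum>j | j \<in> {1..Nr} \<and> j \<in> A i. g i j)"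
    using A_subset by (intro sum.cong) fastforce+
  also have "\<dots> = (\<Sum>j\<in>{1..Nr}. \<Sum>i | i \<in> {1..Nc} \<and> j \<in> A i. g i j)"
    by (rule sum.swap_restrict) auto
  finally show ?thesis by (simp add: bidders_def)
qed

lemma D_nonneg: "j \<in> {1..Nr} \<Longrightarrow> 0 \<le> x \<Longrightarrow> 0 \<le> D j x"
  using supply_D by (simp add: supply_curve_def)

lemma D_mono: "j \<in> {1..Nr} \<Longrightarrow> 0 \<le> x \<Longrightarrow> x \<le> y \<Longrightarrow> D j x \<le> D j y"
  using supply_D by (simp add: supply_curve_def mono_on_def)

lemma F_tangent:
  "j \<in> {1..Nr} \<Longrightarrow> 0 \<le> x \<Longrightarrow> 0 \<le> y \<Longrightarrow> D j x * (y - x) \<le> F j y - F j x"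
  unfolding F_def by (intro supply_curve_integral_tangent supply_D cont_D)

lemma F_mono: "j \<in> {1..Nr} \<Longrightarrow> 0 \<le> x \<Longrightarrow> x \<le> y \<Longrightarrow> F j x \<le> F j y"
  unfolding F_def by (intro supply_curve_integral_mono supply_D cont_D)

lemma F_nonneg: "j \<in> {1..Nr} \<Longrightarrow> 0 \<le> x \<Longrightarrow> 0 \<le> F j x"
  using F_mono[of j 0 x] by (simp add: F_def)

lemma le_top_bid: "i \<in> bidders Nc A j \<Longrightarrow> \<pi> i \<le> top_bid \<pi> j"
  by (simp add: top_bid_def)

lemma top_bid_le:
  assumes "j \<in> {1..Nr}" "\<And>i. i \<in> bidders Nc A j \<Longrightarrow> \<pi> i \<le> c"
  shows "top_bid \<pi> j \<le> c"
  using assms bidders_nonempty by (simp add: top_bid_def)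

lemma top_bid_attained:
  assumes "j \<in> {1..Nr}"
  obtains i where "i \<in> bidders Nc A j" "\<pi> i = top_bid \<pi> j"
proof -
  have "top_bid \<pi> j \<in> \<pi> ` bidders Nc A j"
    unfolding top_bid_def using assms bidders_nonempty by (intro Max_in) auto
  then show ?thesis using that by auto
qed

lemma top_bid_nonneg:
  assumes "j \<in> {1..Nr}" "\<And>i. 0 \<le> \<pi> i"
  shows "0 \<le> top_bid \<pi> j"
  using top_bid_attained[OF assms(1), of \<pi>] assms(2) by metis

lemma cost_eq:
  assumes "allocation Nc Nr A b \<gamma>"
  shows "cost Nc Nr D b \<gamma> = (\<Sum>i\<in>{1..Nc}. \<Sum>j\<in>A i. \<gamma> i j * (D j (b i j) * b i j - F j (b i j)))"
  unfolding cost_def F_def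
proof (rule sum.cong[OF refl])
  fix i assume "i \<in> {1..Nc}"
  then show "(\<Sum>j\<in>{1..Nr}. \<gamma> i j * (D j (b i j) * b i j - integral {0..b i j} (D j))) =
      (\<Sum>j\<in>A i. \<gamma> i j * (D j (b i j) * b i j - integral {0..b i j} (D j)))"
    using A_subset[of i] assms by (intro sum.mono_neutral_right) (auto simp: allocation_def)
qed

section \<open>Weak duality and attainment of the dual maximum\<close>

lemma feasible_nonneg:
  assumes "feasible Nc Nr A I D b \<gamma>" "i \<in> {1..Nc}" "j \<in> A i"
  shows "0 \<le> b i j" "0 \<le> \<gamma> i j"
  using assms by (auto simp: feasible_def allocation_def)

text \<open>Weight the demand constraints by \<pi>. Each supplied share is worth at most its cost
  plus its fraction of \<open>F j (top_bid \<pi> j)\<close>, and these fractions add up to at most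
  one in each group.\<close>

lemma weak_duality:
  assumes feas: "feasible Nc Nr A I D b \<gamma>" and \<pi>: "\<And>i. 0 \<le> \<pi> i"
  shows "dual \<pi> \<le> cost Nc Nr D b \<gamma>"
proof -
  note nonneg = feasible_nonneg[OF feas]
  have "(\<Sum>i\<in>{1..Nc}. \<pi> i * I i) \<le> (\<Sum>i\<in>{1..Nc}. \<pi> i * (\<Sum>j\<in>A i. \<gamma> i j * D j (b i j)))"
    using feas \<pi> by (intro sum_mono mult_left_mono) (auto simp: feasible_def)
  also have "\<dots> = (\<Sum>i\<in>{1..Nc}. \<Sum>j\<in>A i. \<gamma> i j * (D j (b i j) * \<pi> i))"
    by (simp add: sum_distrib_left mult_ac)
  also have "\<dots> \<le> (\<Sum>i\<in>{1..Nc}. \<Sum>j\<in>A i.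
      \<gamma> i j * (D j (b i j) * b i j - F j (b i j)) + \<gamma> i j * F j (top_bid \<pi> j))"
  proof (intro sum_mono)
    fix i j assume ij: "i \<in> {1..Nc}" "j \<in> A i"
    then have j: "j \<in> {1..Nr}" and i: "i \<in> bidders Nc A j"
      using A_subset by (fastforce simp: bidders_def)+
    have "D j (b i j) * (\<pi> i - b i j) \<le> F j (\<pi> i) - F j (b i j)"
      using F_tangent j nonneg[OF ij] \<pi> by simp
    also have "\<dots> \<le> F j (top_bid \<pi> j) - F j (b i j)"
      using F_mono[OF j \<pi>] le_top_bid[OF i] by simp
    finally have "\<gamma> i j * (D j (b i j) * \<pi> i)
        \<le> \<gamma> i j * (D j (b i j) * b i j - F j (b i j) + F j (top_bid \<pi> j))"
      using nonneg[OF ij] by (intro mult_left_mono) (auto simp: algebra_simps)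
    then show "\<gamma> i j * (D j (b i j) * \<pi> i)
        \<le> \<gamma> i j * (D j (b i j) * b i j - F j (b i j)) + \<gamma> i j * F j (top_bid \<pi> j)"
      by (simp add: algebra_simps)
  qed
  also have "\<dots> = cost Nc Nr D b \<gamma> +
      (\<Sum>j\<in>{1..Nr}. \<Sum>i\<in>bidders Nc A j. \<gamma> i j * F j (top_bid \<pi> j))"
    using feas sum_swap_bidders[of "\<lambda>i j. \<gamma> i j * F j (top_bid \<pi> j)"]
    by (simp add: cost_eq feasible_def sum.distrib)
  also have "(\<Sum>j\<in>{1..Nr}. \<Sum>i\<in>bidders Nc A j. \<gamma> i j * F j (top_bid \<pi> j))
      \<le> (\<Sum>j\<in>{1..Nr}. F j (top_bid \<pi> j))"
    unfolding sum_distrib_right[symmetric]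
    using feas \<pi>
    by (intro sum_mono mult_left_le_one_le F_nonneg top_bid_nonneg sum_nonneg)
       (auto simp: feasible_def allocation_def bidders_def)
  finally show ?thesis by (simp add: dual_def)
qed

text \<open>Truncating the multipliers at a bound for the bids of some feasible solution does not
  decrease the dual objective, which makes up for the missing coercivity of \<^const>\<open>dual\<close>.\<close>

lemma dual_le_truncated:
  assumes feas: "feasible Nc Nr A I D b \<gamma>"
    and bM: "\<And>i j. i \<in> {1..Nc} \<Longrightarrow> j \<in> A i \<Longrightarrow> b i j \<le> M" and M: "0 \<le> M"
    and \<pi>: "\<And>i. 0 \<le> \<pi> i"
  shows "dual \<pi> \<le> dual (\<lambda>i. min (\<pi> i) M)"
proof -
  note nonneg = feasible_nonneg[OF feas]
  \<comment> \<open>The amounts cut off from the multipliers and from the top bids. Truncation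
    commutes with the maximum, so \<open>y j\<close> dominates \<open>x i\<close> for every bidder
    of \<open>j\<close>.\<close>
  define x where "x i = \<pi> i - min (\<pi> i) M" for i
  define y where "y j = top_bid \<pi> j - top_bid (\<lambda>i. min (\<pi> i) M) j" for j
  have x: "0 \<le> x i" for i by (simp add: x_def)
  have top: "top_bid (\<lambda>i. min (\<pi> i) M) j = min (top_bid \<pi> j) M" if j: "j \<in> {1..Nr}" for j
  proof (rule antisym)
    show "top_bid (\<lambda>i. min (\<pi> i) M) j \<le> min (top_bid \<pi> j) M"
      using le_top_bid[of _ j \<pi>] by (intro top_bid_le j) (auto simp: min_le_iff_disj)
    obtain i where "i \<in> bidders Nc A j" "\<pi> i = top_bid \<pi> j" using top_bid_attained[OF j] .
    then show "min (top_bid \<pi> j) M \<le> top_bid (\<lambda>i. min (\<pi> i) M) j"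
      using le_top_bid[of i j "\<lambda>i. min (\<pi> i) M"] by simp
  qed
  have xy: "x i \<le> y j" if "i \<in> bidders Nc A j" "j \<in> {1..Nr}" for i j
    using le_top_bid[OF that(1), of \<pi>] that by (auto simp: x_def y_def top)
  have y: "0 \<le> y j" if "j \<in> {1..Nr}" for j using that by (simp add: y_def top)
  have "(\<Sum>i\<in>{1..Nc}. x i * I i) \<le> (\<Sum>i\<in>{1..Nc}. x i * (\<Sum>j\<in>A i. \<gamma> i j * D j (b i j)))"
    using feas x by (intro sum_mono mult_left_mono) (auto simp: feasible_def)
  also have "\<dots> = (\<Sum>i\<in>{1..Nc}. \<Sum>j\<in>A i. \<gamma> i j * (D j (b i j) * x i))"
    by (simp add: sum_distrib_left mult_ac)
  \<comment> \<open>The feasible solution meets all demands with bids up to \<open>M\<close>, so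
    \<open>D j M\<close> bounds the supply it draws on.\<close>
  also have "\<dots> \<le> (\<Sum>i\<in>{1..Nc}. \<Sum>j\<in>A i. \<gamma> i j * (D j M * y j))"
  proof (intro sum_mono)
    fix i j assume ij: "i \<in> {1..Nc}" "j \<in> A i"
    then have j: "j \<in> {1..Nr}" and i: "i \<in> bidders Nc A j"
      using A_subset by (fastforce simp: bidders_def)+
    show "\<gamma> i j * (D j (b i j) * x i) \<le> \<gamma> i j * (D j M * y j)"
      using nonneg[OF ij] bM[OF ij] x xy[OF i j] j M
      by (intro mult_left_mono mult_mono D_mono D_nonneg) auto
  qed
  also have "\<dots> = (\<Sum>j\<in>{1..Nr}. \<Sum>i\<in>bidders Nc A j. \<gamma> i j * (D j M * y j))"
    by (rule sum_swap_bidders)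
  also have "\<dots> \<le> (\<Sum>j\<in>{1..Nr}. D j M * y j)"
    unfolding sum_distrib_right[symmetric]
    using feas y M
    by (intro sum_mono mult_left_le_one_le mult_nonneg_nonneg D_nonneg sum_nonneg)
       (auto simp: feasible_def allocation_def bidders_def)
  \<comment> \<open>Above \<open>M\<close> the slope of \<open>F j\<close> is at least
    \<open>D j M\<close>, so the truncation saves at least what it gives up.\<close>
  also have "\<dots> \<le> (\<Sum>j\<in>{1..Nr}. F j (top_bid \<pi> j) - F j (top_bid (\<lambda>i. min (\<pi> i) M) j))"
  proof (rule sum_mono)
    fix j assume j: "j \<in> {1..Nr}"
    show "D j M * y j \<le> F j (top_bid \<pi> j) - F j (top_bid (\<lambda>i. min (\<pi> i) M) j)"
      using F_tangent[OF j M, of "top_bid \<pi> j"] top_bid_nonneg[of j \<pi>] \<pi> j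
      by (cases "top_bid \<pi> j \<le> M") (auto simp: y_def top)
  qed
  finally show ?thesis
    by (simp add: dual_def x_def algebra_simps sum_subtractf)
qed

lemma continuous_on_dual: "continuous_on {\<pi>. \<forall>i. \<pi> i \<in> {0..M}} dual"
proof -
  let ?S = "{\<pi> :: nat \<Rightarrow> real. \<forall>i. \<pi> i \<in> {0..M}}"
  have coord: "continuous_on ?S (\<lambda>\<pi>. \<pi> i)" for i
    by (rule continuous_on_product_then_coordinatewise[OF continuous_on_id])
  have "continuous_on ?S (\<lambda>\<pi>. F j (top_bid \<pi> j))" if j: "j \<in> {1..Nr}" for j
  proof (rule continuous_on_compose2[of "{0..M}" "F j"])
    show "continuous_on {0..M} (F j)"
      unfolding F_def
      by (intro indefinite_integral_continuous_1 integrable_on_Icc_if_continuous_nonneg cont_D j) simp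
    show "continuous_on ?S (\<lambda>\<pi>. top_bid \<pi> j)"
      unfolding top_bid_def
      using bidders_nonempty[OF j] coord by (intro continuous_on_Max_image) auto
    show "(\<lambda>\<pi>. top_bid \<pi> j) ` ?S \<subseteq> {0..M}"
      using j by (auto intro!: top_bid_nonneg top_bid_le)
  qed
  then show ?thesis
    unfolding dual_def
    by (intro continuous_on_diff continuous_on_sum continuous_on_mult coord continuous_on_const)
qed

text \<open>A maximiser over the compact box \<open>[0, M]\<close> is global, because truncation at
  \<open>M\<close> sends all nonnegative multipliers into the box without loss.\<close>

lemma dual_attained:
  assumes feas: "feasible Nc Nr A I D b \<gamma>"
  obtains \<pi> where "\<And>i. 0 \<le> \<pi> i" "\<And>\<mu>. (\<And>i. 0 \<le> \<mu> i) \<Longrightarrow> dual \<mu> \<le> dual \<pi>"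
proof -
  note nonneg = feasible_nonneg[OF feas]
  \<comment> \<open>The bids are nonnegative, so their sum bounds each of them.\<close>
  define M where "M = (\<Sum>i\<in>{1..Nc}. \<Sum>j\<in>A i. b i j)"
  have M: "0 \<le> M" unfolding M_def using nonneg by (intro sum_nonneg) auto
  have bM: "b i j \<le> M" if ij: "i \<in> {1..Nc}" "j \<in> A i" for i j
  proof -
    have "b i j \<le> (\<Sum>j\<in>A i. b i j)"
      using ij nonneg finite_A by (intro member_le_sum) auto
    also have "\<dots> \<le> M"
      unfolding M_def using ij nonneg
      by (intro member_le_sum[of i _ "\<lambda>i. \<Sum>j\<in>A i. b i j"]) (auto intro!: sum_nonneg)
    finally show ?thesis .
  qed
  let ?S = "{\<pi> :: nat \<Rightarrow> real. \<forall>i. \<pi> i \<in> {0..M}}"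
  have "compact ?S" by (intro compact_box) auto
  moreover have "?S \<noteq> {}" using M by (auto intro!: exI[of _ "\<lambda>_. 0"])
  ultimately obtain \<pi> where \<pi>: "\<pi> \<in> ?S" "\<And>\<mu>. \<mu> \<in> ?S \<Longrightarrow> dual \<mu> \<le> dual \<pi>"
    using continuous_attains_sup[OF _ _ continuous_on_dual] by blast
  show ?thesis
  proof (rule that[of \<pi>])
    fix \<mu> :: "nat \<Rightarrow> real" assume \<mu>: "\<And>i. 0 \<le> \<mu> i"
    have "dual \<mu> \<le> dual (\<lambda>i. min (\<mu> i) M)"
      by (rule dual_le_truncated[OF feas bM M \<mu>])
    also have "\<dots> \<le> dual \<pi>" using \<mu> M by (intro \<pi>(2)) auto
    finally show "dual \<mu> \<le> dual \<pi>" .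
  qed (use \<pi> in auto)
qed

section \<open>First-order condition at a dual maximiser\<close>

definition top_bidders :: "(nat \<Rightarrow> real) \<Rightarrow> nat \<Rightarrow> nat set" where
  "top_bidders \<pi> j = {i \<in> bidders Nc A j. \<pi> i = top_bid \<pi> j}"

text \<open>The directional derivative of \<open>dual\<close> at \<pi> along \<open>v\<close> is not
  positive. The direction is admissible since \<open>v\<close> decreases only positive multipliers,
  and a maximum varies at the largest rate among its maximisers.\<close>

lemma dual_first_order:
  assumes \<pi>: "\<And>i. 0 \<le> \<pi> i" and max: "\<And>\<mu>. (\<And>i. 0 \<le> \<mu> i) \<Longrightarrow> dual \<mu> \<le> dual \<pi>"
    and v: "\<And>i. \<pi> i = 0 \<Longrightarrow> 0 \<le> v i"
  shows "(\<Sum>i\<in>{1..Nc}. v i * I i)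
    \<le> (\<Sum>j\<in>{1..Nr}. D j (top_bid \<pi> j) * Max (v ` top_bidders \<pi> j))"
proof -
  define w where "w j = Max (v ` top_bidders \<pi> j)" for j
  let ?m = "top_bid \<pi>"
  \<comment> \<open>only finitely many constraints, so that one step size is admissible for all of them\<close>
  define \<mu> where "\<mu> t i = (if i \<in> {1..Nc} then \<pi> i + t * v i else 0)" for t i
  have v_le_w: "v i \<le> w j" if "i \<in> top_bidders \<pi> j" for i j
    unfolding w_def using that by (intro Max_ge) (auto simp: top_bidders_def)
  have adm: "\<forall>\<^sub>F t in at_right 0. \<forall>i\<in>{1..Nc}. 0 \<le> \<pi> i + t * v i"
  proof (intro eventually_ball_finite ballI)
    fix i
    show "\<forall>\<^sub>F t in at_right 0. 0 \<le> \<pi> i + t * v i"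
    proof (cases "\<pi> i = 0")
      case True
      then show ?thesis using v[of i] eventually_at_right_less[of 0]
        by (auto elim!: eventually_mono)
    next
      case False
      have "((\<lambda>t. \<pi> i + t * v i) \<longlongrightarrow> \<pi> i + 0 * v i) (at_right 0)"
        by (intro tendsto_intros)
      then have "\<forall>\<^sub>F t in at_right 0. 0 < \<pi> i + t * v i"
        using False \<pi>[of i] by (intro order_tendstoD(1)[of _ "\<pi> i + 0 * v i"]) auto
      then show ?thesis by (rule eventually_mono) simp
    qed
  qed simp
  \<comment> \<open>Top bidders move at rate at most \<open>w j\<close>; the others start strictly
    below and stay below for small \<open>t\<close>.\<close>
  have top: "\<forall>\<^sub>F t in at_right 0. \<forall>j\<in>{1..Nr}. \<forall>i\<in>bidders Nc A j. \<pi> i + t * v i \<le> ?m j + t * w j"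
  proof (intro eventually_ball_finite ballI)
    fix i j assume i: "i \<in> bidders Nc A j"
    show "\<forall>\<^sub>F t in at_right 0. \<pi> i + t * v i \<le> ?m j + t * w j"
    proof (cases "\<pi> i = ?m j")
      case True
      then have "v i \<le> w j" using i by (intro v_le_w) (simp add: top_bidders_def)
      then show ?thesis using True eventually_at_right_less[of 0]
        by (auto elim!: eventually_mono intro: mult_left_mono)
    next
      case False
      then have "\<pi> i < ?m j" using le_top_bid[OF i, of \<pi>] by simp
      moreover have "((\<lambda>t. (?m j + t * w j) - (\<pi> i + t * v i)) \<longlongrightarrow>
          (?m j + 0 * w j) - (\<pi> i + 0 * v i)) (at_right 0)"
        by (intro tendsto_intros)
      ultimately have "\<forall>\<^sub>F t in at_right 0. 0 < (?m j + t * w j) - (\<pi> i + t * v i)"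
        by (intro order_tendstoD(1)[of _ "(?m j + 0 * w j) - (\<pi> i + 0 * v i)"]) auto
      then show ?thesis by (rule eventually_mono) simp
    qed
  qed auto
  \<comment> \<open>The bound dominates the moved multiplier of some bidder, so it stays in the
    domain where \<open>D j\<close> is continuous and the tangent inequality holds.\<close>
  have nn: "\<forall>\<^sub>F t in at_right 0. \<forall>j\<in>{1..Nr}. 0 \<le> ?m j + t * w j"
    using adm top
  proof eventually_elim
    case (elim t)
    show ?case
    proof
      fix j assume j: "j \<in> {1..Nr}"
      obtain i where i: "i \<in> bidders Nc A j" using bidders_nonempty[OF j] by auto
      then have "i \<in> {1..Nc}" by (simp add: bidders_def)
      with elim i j show "0 \<le> ?m j + t * w j" by fastforce
    qed
  qed
  have le: "\<forall>\<^sub>F t in at_right 0.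
      (\<Sum>i\<in>{1..Nc}. v i * I i) \<le> (\<Sum>j\<in>{1..Nr}. D j (?m j + t * w j) * w j)"
    using adm top nn eventually_at_right_less[of 0]
  proof eventually_elim
    case (elim t)
    have \<mu>: "0 \<le> \<mu> t i" for i using elim(1) by (simp add: \<mu>_def)
    have "(\<Sum>i\<in>{1..Nc}. \<mu> t i * I i) - (\<Sum>i\<in>{1..Nc}. \<pi> i * I i)
        \<le> (\<Sum>j\<in>{1..Nr}. F j (top_bid (\<mu> t) j)) - (\<Sum>j\<in>{1..Nr}. F j (?m j))"
      using max[of "\<mu> t", OF \<mu>] by (simp add: dual_def)
    moreover have "(\<Sum>i\<in>{1..Nc}. \<mu> t i * I i) - (\<Sum>i\<in>{1..Nc}. \<pi> i * I i) = t * (\<Sum>i\<in>{1..Nc}. v i * I i)"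
      unfolding sum_distrib_left sum_subtractf[symmetric]
      by (intro sum.cong) (auto simp: \<mu>_def algebra_simps)
    moreover have "(\<Sum>j\<in>{1..Nr}. F j (top_bid (\<mu> t) j)) - (\<Sum>j\<in>{1..Nr}. F j (?m j))
        \<le> t * (\<Sum>j\<in>{1..Nr}. D j (?m j + t * w j) * w j)"
      unfolding sum_distrib_left sum_subtractf[symmetric]
    proof (rule sum_mono)
      fix j assume j: "j \<in> {1..Nr}"
      have "top_bid (\<mu> t) j \<le> ?m j + t * w j"
        using elim(2) j by (intro top_bid_le) (auto simp: \<mu>_def bidders_def)
      then have "F j (top_bid (\<mu> t) j) - F j (?m j) \<le> F j (?m j + t * w j) - F j (?m j)"
        using F_mono[OF j top_bid_nonneg[OF j \<mu>]] by simp
      \<comment> \<open>The tangent is taken at the moved point, which bounds the increment from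
        above; continuity of \<open>D j\<close> brings the slope back to \<open>?m j\<close> in the
        limit.\<close>
      also have "\<dots> \<le> t * (D j (?m j + t * w j) * w j)"
        using F_tangent[OF j, of "?m j + t * w j" "?m j"] elim(3) j top_bid_nonneg[OF j \<pi>]
        by (simp add: algebra_simps)
      finally show "F j (top_bid (\<mu> t) j) - F j (?m j) \<le> t * (D j (?m j + t * w j) * w j)" .
    qed
    ultimately have "t * (\<Sum>i\<in>{1..Nc}. v i * I i) \<le> t * (\<Sum>j\<in>{1..Nr}. D j (?m j + t * w j) * w j)"
      by linarith
    then show ?case using elim(4) by simp
  qed
  have "((\<lambda>t. D j (?m j + t * w j)) \<longlongrightarrow> D j (?m j)) (at_right 0)" if j: "j \<in> {1..Nr}" for j
  proof (rule continuous_on_tendsto_compose[OF cont_D[OF j]])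
    have "((\<lambda>t. ?m j + t * w j) \<longlongrightarrow> ?m j + 0 * w j) (at_right 0)"
      by (intro tendsto_intros)
    then show "((\<lambda>t. ?m j + t * w j) \<longlongrightarrow> ?m j) (at_right 0)" by simp
    show "?m j \<in> {0..}" using top_bid_nonneg[OF j \<pi>] by simp
    show "\<forall>\<^sub>F t in at_right 0. ?m j + t * w j \<in> {0..}"
      using nn by (rule eventually_mono) (use j in auto)
  qed
  then have "((\<lambda>t. \<Sum>j\<in>{1..Nr}. D j (?m j + t * w j) * w j) \<longlongrightarrow>
      (\<Sum>j\<in>{1..Nr}. D j (?m j) * w j)) (at_right 0)"
    by (intro tendsto_sum tendsto_mult tendsto_const)
  from tendsto_lowerbound[OF this le] show ?thesis by (simp add: w_def)
qed

section \<open>Recovery of an optimal allocation\<close>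

text \<open>The first-order condition is the hypothesis of \<open>fractional_assignment\<close> with
  \<open>d j = D j (?m j)\<close> and \<open>Z\<close> the campaigns of multiplier zero. The
  resulting cost equals \<open>dual \<pi>\<close>, so weak duality gives optimality.\<close>

lemma optimal_uniform_bids:
  assumes "feasible Nc Nr A I D b\<^sub>0 \<gamma>\<^sub>0"
  obtains \<pi> \<gamma> where "\<And>i. 0 \<le> \<pi> i" "optimal Nc Nr A I D (\<lambda>i j. \<pi> i) \<gamma>"
    "\<And>i j. j \<in> {1..Nr} \<Longrightarrow> \<gamma> i j \<noteq> 0 \<Longrightarrow> \<pi> i = top_bid \<pi> j"
proof -
  obtain \<pi> where \<pi>: "\<And>i. 0 \<le> \<pi> i" and max: "\<And>\<mu>. (\<And>i. 0 \<le> \<mu> i) \<Longrightarrow> dual \<mu> \<le> dual \<pi>"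
    using dual_attained[OF assms] by blast
  let ?m = "top_bid \<pi>"
  obtain \<gamma> where \<gamma>0: "\<And>i j. 0 \<le> \<gamma> i j"
    and supp: "\<And>i j. j \<in> {1..Nr} \<Longrightarrow> i \<notin> top_bidders \<pi> j \<Longrightarrow> \<gamma> i j = 0"
    and one: "\<And>j. j \<in> {1..Nr} \<Longrightarrow> (\<Sum>i\<in>{1..Nc}. \<gamma> i j) = 1"
    and ge: "\<And>i. i \<in> {1..Nc} \<Longrightarrow> I i \<le> (\<Sum>j\<in>{1..Nr}. \<gamma> i j * D j (?m j))"
    and eq: "\<And>i. i \<in> {1..Nc} - {i. \<pi> i = 0} \<Longrightarrow> I i = (\<Sum>j\<in>{1..Nr}. \<gamma> i j * D j (?m j))"
  proof (rule fractional_assignment[of "{1..Nc}" "{1..Nr}" "top_bidders \<pi>" "{i. \<pi> i = 0}" I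
        "\<lambda>j. D j (?m j)"])
    fix j assume j: "j \<in> {1..Nr}"
    show "top_bidders \<pi> j \<noteq> {}"
      using top_bid_attained[OF j, of \<pi>] by (auto simp: top_bidders_def)
    show "top_bidders \<pi> j \<subseteq> {1..Nc}" by (auto simp: top_bidders_def bidders_def)
  next
    fix v :: "nat \<Rightarrow> real" assume "\<And>i. i \<in> {i. \<pi> i = 0} \<Longrightarrow> 0 \<le> v i"
    then show "(\<Sum>i\<in>{1..Nc}. v i * I i) \<le> (\<Sum>j\<in>{1..Nr}. D j (?m j) * Max (v ` top_bidders \<pi> j))"
      using \<pi> max by (intro dual_first_order) auto
  qed auto
  have notA: "\<gamma> i j = 0" if "i \<in> {1..Nc}" "j \<in> {1..Nr} - A i" for i j
    using that by (intro supp) (auto simp: top_bidders_def bidders_def)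
  have tight: "\<pi> i = ?m j" if "j \<in> {1..Nr}" "\<gamma> i j \<noteq> 0" for i j
    using supp[OF that(1), of i] that by (auto simp: top_bidders_def)
  \<comment> \<open>On the support of \<open>\<gamma>\<close> the campaign's bid is the top bid of
    the group, so the two may be exchanged under the weights.\<close>
  have sumA: "(\<Sum>j\<in>A i. \<gamma> i j * g (\<pi> i) j) = (\<Sum>j\<in>{1..Nr}. \<gamma> i j * g (?m j) j)"
    if i: "i \<in> {1..Nc}" for i and g :: "real \<Rightarrow> nat \<Rightarrow> real"
  proof -
    have "(\<Sum>j\<in>{1..Nr}. \<gamma> i j * g (?m j) j) = (\<Sum>j\<in>A i. \<gamma> i j * g (?m j) j)"
      using A_subset[OF i] notA[OF i] by (intro sum.mono_neutral_right) auto
    also have "\<dots> = (\<Sum>j\<in>A i. \<gamma> i j * g (\<pi> i) j)"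
      using A_subset[OF i] tight[of _ i]
      by (intro sum.cong refl) (metis mult_zero_left subsetD)
    finally show ?thesis ..
  qed
  have alloc: "allocation Nc Nr A (\<lambda>i j. \<pi> i) \<gamma>"
    using \<pi> \<gamma>0 notA by (auto simp: allocation_def)
  have bidders1: "(\<Sum>i\<in>bidders Nc A j. \<gamma> i j) = 1" if j: "j \<in> {1..Nr}" for j
  proof -
    have "(\<Sum>i\<in>{1..Nc}. \<gamma> i j) = (\<Sum>i\<in>bidders Nc A j. \<gamma> i j)"
      using j notA by (intro sum.mono_neutral_right) (auto simp: bidders_def)
    with one[OF j] show ?thesis by simp
  qed
  have feas: "feasible Nc Nr A I D (\<lambda>i j. \<pi> i) \<gamma>"
    using alloc ge sumA[where g = "\<lambda>x j. D j x"] bidders1 by (simp add: feasible_def)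
  have "cost Nc Nr D (\<lambda>i j. \<pi> i) \<gamma> =
      (\<Sum>i\<in>{1..Nc}. \<Sum>j\<in>A i. \<pi> i * (\<gamma> i j * D j (\<pi> i)) - \<gamma> i j * F j (\<pi> i))"
    by (simp add: cost_eq[OF alloc] algebra_simps)
  also have "\<dots> = (\<Sum>i\<in>{1..Nc}. \<pi> i * I i - (\<Sum>j\<in>{1..Nr}. \<gamma> i j * F j (?m j)))"
  proof (rule sum.cong[OF refl])
    fix i assume i: "i \<in> {1..Nc}"
    \<comment> \<open>Complementary slackness: the demand is met exactly unless the multiplier is
      zero.\<close>
    have "\<pi> i * (\<Sum>j\<in>A i. \<gamma> i j * D j (\<pi> i)) = \<pi> i * I i"
      using eq[of i] i sumA[OF i, of "\<lambda>x j. D j x"] by (cases "\<pi> i = 0") auto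
    then show "(\<Sum>j\<in>A i. \<pi> i * (\<gamma> i j * D j (\<pi> i)) - \<gamma> i j * F j (\<pi> i)) =
        \<pi> i * I i - (\<Sum>j\<in>{1..Nr}. \<gamma> i j * F j (?m j))"
      using sumA[OF i, of "\<lambda>x j. F j x"] by (simp add: sum_subtractf sum_distrib_left)
  qed
  also have "\<dots> = (\<Sum>i\<in>{1..Nc}. \<pi> i * I i) - (\<Sum>j\<in>{1..Nr}. (\<Sum>i\<in>{1..Nc}. \<gamma> i j) * F j (?m j))"
    unfolding sum_subtractf sum_distrib_right by (subst (2) sum.swap) (rule refl)
  also have "\<dots> = dual \<pi>"
    using one by (simp add: dual_def)
  finally have "cost Nc Nr D (\<lambda>i j. \<pi> i) \<gamma> = dual \<pi>" .
  then have "optimal Nc Nr A I D (\<lambda>i j. \<pi> i) \<gamma>"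
    using feas weak_duality \<pi> by (auto simp: optimal_def)
  with \<pi> tight show ?thesis by (intro that)
qed

end

section \<open>Components as level sets of the bids\<close>

theorem proposition5:
  fixes Nc Nr :: nat
    and A :: "nat \<Rightarrow> nat set"
    and I :: "nat \<Rightarrow> real"
    and D :: "nat \<Rightarrow> real \<Rightarrow> real"
  assumes "\<And>i. i \<in> {1..Nc} \<Longrightarrow> I i \<ge> 0"
    and "\<And>i. i \<in> {1..Nc} \<Longrightarrow> A i \<subseteq> {1..Nr}"
    and "\<And>j. j \<in> {1..Nr} \<Longrightarrow> bidders Nc A j \<noteq> {}"
    and "\<And>j. j \<in> {1..Nr} \<Longrightarrow> supply_curve (D j)"
    and "\<And>j. j \<in> {1..Nr} \<Longrightarrow> continuous_on {0..} (D j)"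
    and "\<exists>b \<gamma>. feasible Nc Nr A I D b \<gamma>"
  shows "\<exists>b \<gamma>. optimal Nc Nr A I D b \<gamma> \<and>
    (\<exists>(P :: real set) (Cc :: real \<Rightarrow> nat set) (Ct :: real \<Rightarrow> nat set).
       P \<subseteq> {0..} \<and>
       (\<forall>p\<in>P.
          Cc p \<subseteq> {1..Nc} \<and> Ct p \<subseteq> {1..Nr} \<and>
          (\<forall>i\<in>Cc p. active_targets A D b \<gamma> i \<inter> Ct p = active_targets A D b \<gamma> i) \<and>
          (\<forall>j\<in>Ct p. active_bidders Nc A D b \<gamma> j \<inter> Cc p = active_bidders Nc A D b \<gamma> j) \<and>
          (\<forall>i\<in>Cc p. \<forall>j\<in>active_targets A D b \<gamma> i. b i j = p)) \<and>
       (\<Union>p\<in>P. Cc p) = {1..Nc} \<and>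
       (\<Union>p\<in>P. Ct p) = {1..Nr})"
proof -
  interpret ad_market Nc Nr A I D
    by unfold_locales (use assms in auto)
  obtain \<pi> \<gamma> where \<pi>: "\<And>i. 0 \<le> \<pi> i"
    and opt: "optimal Nc Nr A I D (\<lambda>i j. \<pi> i) \<gamma>"
    and tight: "\<And>i j. j \<in> {1..Nr} \<Longrightarrow> \<gamma> i j \<noteq> 0 \<Longrightarrow> \<pi> i = top_bid \<pi> j"
    using assms(6) optimal_uniform_bids by metis
  \<comment> \<open>Campaigns are sorted by their own bid and groups by their top bid; taking both
    images makes the components cover all campaigns and all groups.\<close>
  define P where "P = \<pi> ` {1..Nc} \<union> top_bid \<pi> ` {1..Nr}"
  define Cc where "Cc p = {i \<in> {1..Nc}. \<pi> i = p}" for p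
  define Ct where "Ct p = {j \<in> {1..Nr}. top_bid \<pi> j = p}" for p
  have "P \<subseteq> {0..}" using \<pi> top_bid_nonneg by (auto simp: P_def)
  \<comment> \<open>An active pair has a nonzero fraction, so by \<open>tight\<close> its campaign
    and its group lie on the same level.\<close>
  moreover have "active_targets A D (\<lambda>i j. \<pi> i) \<gamma> i \<subseteq> Ct p" if "i \<in> Cc p" for i p
    using that assms(2)[of i] tight[of _ i] by (fastforce simp: Cc_def Ct_def active_targets_def)
  moreover have "active_bidders Nc A D (\<lambda>i j. \<pi> i) \<gamma> j \<subseteq> Cc p" if "j \<in> Ct p" for j p
    using that tight[of j]
    by (auto simp: Cc_def Ct_def active_bidders_def bidders_def)
      (metis less_irrefl mult_zero_left)
  moreover have "(\<Union>p\<in>P. Cc p) = {1..Nc}" "(\<Union>p\<in>P. Ct p) = {1..Nr}"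
    by (auto simp: P_def Cc_def Ct_def)
  moreover have "Cc p \<subseteq> {1..Nc}" "Ct p \<subseteq> {1..Nr}" "\<forall>i\<in>Cc p. \<pi> i = p" for p
    by (auto simp: Cc_def Ct_def)
  ultimately show ?thesis
    using opt
    by (intro exI[of _ "\<lambda>i j. \<pi> i"] exI[of _ \<gamma>] conjI exI[of _ P] exI[of _ Cc] exI[of _ Ct])
      (simp_all add: Int_absorb2)
qed

end
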